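(* Let $\delta\ge 0$, let $\mu_1,\dots,\mu_N>0$, $\mathbf D=\operatorname{diag}(\mu_1,\dots,\mu_N)$, and let $\mathbf G\in\mathbb R^{N\times N}$ be symmetric and entry-wise non-negative with zero diagonal. Then the contraction condition $\rho(\delta\,\mathbf D^{-1}|\mathbf G|)<1$ and the variational condition $\mathbf D-\delta\,\frac{\mathbf G+\mathbf G^\top}{2}\succ 0$ are equivalent, and both are equivalent to $$\delta\,\rho(\mathbf D^{-1}\mathbf G)<1 .$$
   Context: $\rho(\cdot)$ is the spectral radius; $|\mathbf G|$ is the entry-wise absolute value of $\mathbf G$; $\mathbf M\succ 0$ means $\mathbf z^\top\mathbf M\mathbf z>0$ for all $\mathbf z\neq\mathbf 0$. *)

theory Defs
  imports
    "Jordan_Normal_Form.Spectral_Radius"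
    "Jordan_Normal_Form.Gauss_Jordan_Elimination"
begin

(* The spectral radius of a real matrix takes its complex eigenvalues into account.
   For the 0 x 0 matrix it is unspecified, being the maximum of an empty set. *)
definition rho :: "real mat \<Rightarrow> real" where
  "rho A = spectral_radius (map_mat complex_of_real A)"

(* Unspecified if the matrix is not invertible. *)
definition inv_mat :: "'a :: field mat \<Rightarrow> 'a mat" where
  "inv_mat A = the (mat_inverse A)"

lemma inv_mat_eqI:
  fixes A B :: "'a :: field mat"
  assumes A: "A \<in> carrier_mat n n" and B: "B \<in> carrier_mat n n"
    and AB: "A * B = 1\<^sub>m n" and BA: "B * A = 1\<^sub>m n"
  shows "inv_mat A = B"
proof (cases "mat_inverse A")
  case None
  have "A \<in> Units (ring_mat TYPE('a) n n)"
    using A B AB BA unfolding Units_def ring_mat_def by auto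
  with mat_inverse(1)[OF A None, where b = n] show ?thesis by blast
next
  case (Some C)
  from mat_inverse(2)[OF A Some] have CA: "C * A = 1\<^sub>m n" and C: "C \<in> carrier_mat n n"
    by auto
  have "C = C * (A * B)" using C AB by simp
  also have "\<dots> = (C * A) * B" using assoc_mult_mat[OF C A B] by simp
  also have "\<dots> = B" using CA B by simp
  finally show ?thesis by (simp add: inv_mat_def Some)
qed

(* No symmetry is required: the condition is only on the quadratic form. *)
definition pos_def_mat :: "real mat \<Rightarrow> bool" where
  "pos_def_mat M \<longleftrightarrow> dim_row M = dim_col M \<and>
     (\<forall>z \<in> carrier_vec (dim_col M). z \<noteq> 0\<^sub>v (dim_col M) \<longrightarrow> z \<bullet> (M *\<^sub>v z) > 0)"

end

theory Submission
  imports Defs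
begin

text \<open>
  Put \<open>M = D\<^sup>-\<^sup>1 G\<close> and \<open>\<langle>x, y\<rangle> = x \<bullet> D y\<close>, so that \<open>M\<close> is self-adjoint for this
  inner product and \<open>z \<bullet> G z = \<langle>z, M z\<rangle>\<close>. Everything follows once the largest Rayleigh quotient
  of \<open>M\<close> is identified with \<open>\<rho>(M)\<close>. It is at most \<open>\<rho>(M)\<close>: after scaling, a Rayleigh quotient
  above \<open>1\<close> makes \<open>\<langle>M\<^sup>k z, M\<^sup>k z\<rangle>\<close> grow geometrically, whereas the powers of a matrix of
  spectral radius below \<open>1\<close> are bounded. It is at least \<open>\<rho>(M)\<close> because \<open>M\<close> is nonnegative: the
  entrywise modulus \<open>w\<close> of an eigenvector for an eigenvalue of maximal modulus satisfies
  \<open>\<rho>(M) w \<le> M w\<close>.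
\<close>

section \<open>Spectral radius and scaling\<close>

lemma spectrum_smult:
  fixes A :: "complex mat"
  assumes A: "A \<in> carrier_mat n n" and n: "n > 0"
  shows "spectrum (c \<cdot>\<^sub>m A) = (*) c ` spectrum A"
proof
  have smult_vec: "(c \<cdot>\<^sub>m A) *\<^sub>v v = c \<cdot>\<^sub>v (A *\<^sub>v v)" if "v \<in> carrier_vec n" for v
    using A that by (intro eq_vecI) auto
  show "(*) c ` spectrum A \<subseteq> spectrum (c \<cdot>\<^sub>m A)"
  proof
    fix k assume "k \<in> (*) c ` spectrum A"
    then obtain l where k: "k = c * l" and "l \<in> spectrum A" by blast
    then obtain v where v: "v \<in> carrier_vec n" "v \<noteq> 0\<^sub>v n" "A *\<^sub>v v = l \<cdot>\<^sub>v v"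
      using A by (auto simp: spectrum_def eigenvalue_def eigenvector_def)
    then have "(c \<cdot>\<^sub>m A) *\<^sub>v v = k \<cdot>\<^sub>v v"
      by (simp add: k smult_vec smult_smult_assoc)
    with v A show "k \<in> spectrum (c \<cdot>\<^sub>m A)"
      by (auto simp: spectrum_def eigenvalue_def eigenvector_def)
  qed
  show "spectrum (c \<cdot>\<^sub>m A) \<subseteq> (*) c ` spectrum A"
  proof
    fix k assume "k \<in> spectrum (c \<cdot>\<^sub>m A)"
    then obtain v where v: "v \<in> carrier_vec n" "v \<noteq> 0\<^sub>v n"
      "(c \<cdot>\<^sub>m A) *\<^sub>v v = k \<cdot>\<^sub>v v"
      using A by (auto simp: spectrum_def eigenvalue_def eigenvector_def)
    then have eq: "c \<cdot>\<^sub>v (A *\<^sub>v v) = k \<cdot>\<^sub>v v" by (simp add: smult_vec)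
    show "k \<in> (*) c ` spectrum A"
    proof (cases "c = 0")
      case True
      \<comment> \<open>With \<open>c = 0\<close> the eigenvalue \<open>k\<close> must vanish, and
        \<open>0\<close> lies in the image because \<open>n > 0\<close> makes the spectrum of
        \<open>A\<close> nonempty.\<close>
      from v obtain i where i: "i < n" "v $ i \<noteq> 0" by (auto simp: vec_eq_iff)
      have "(c \<cdot>\<^sub>v (A *\<^sub>v v)) $ i = (k \<cdot>\<^sub>v v) $ i" by (simp only: eq)
      with True i v A have "k = 0" by auto
      with True spectrum_non_empty[OF A n] show ?thesis by auto
    next
      case False
      have "A *\<^sub>v v = (1 / c) \<cdot>\<^sub>v (c \<cdot>\<^sub>v (A *\<^sub>v v))"
        using False by (simp add: smult_smult_assoc)
      also have "\<dots> = (k / c) \<cdot>\<^sub>v v" unfolding eq by (simp add: smult_smult_assoc)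
      finally have "k / c \<in> spectrum A"
        using v A by (auto simp: spectrum_def eigenvalue_def eigenvector_def)
      with False show ?thesis by (auto intro!: image_eqI[of _ _ "k / c"])
    qed
  qed
qed

text \<open>For \<open>n > 0\<close> the spectrum is finite and nonempty, so the maximum in
  \<open>rho\<close> is attained. Later arguments use \<open>rho\<close> mostly through these two
  facts.\<close>

lemma rho_mem_max:
  assumes A: "A \<in> carrier_mat n n" and n: "n > 0"
  shows "rho A \<in> norm ` spectrum (map_mat complex_of_real A)"
    and "a \<in> norm ` spectrum (map_mat complex_of_real A) \<Longrightarrow> a \<le> rho A"
  using spectral_radius_mem_max[of "map_mat complex_of_real A" n] A n
  unfolding rho_def by auto

lemma rho_nonneg:
  assumes "A \<in> carrier_mat n n" and "n > 0"
  shows "rho A \<ge> 0"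
  using rho_mem_max(1)[OF assms] by auto

text \<open>Used twice: to normalise a matrix to spectral radius below 1, and to pull \<delta> out
  of the contraction condition.\<close>

lemma rho_smult:
  assumes A: "A \<in> carrier_mat n n" and n: "n > 0"
  shows "rho (c \<cdot>\<^sub>m A) = \<bar>c\<bar> * rho A"
proof -
  let ?S = "spectrum (map_mat complex_of_real A)"
  have "map_mat complex_of_real (c \<cdot>\<^sub>m A) = complex_of_real c \<cdot>\<^sub>m map_mat complex_of_real A"
    using A by (intro eq_matI) auto
  then have S: "norm ` spectrum (map_mat complex_of_real (c \<cdot>\<^sub>m A)) = (*) \<bar>c\<bar> ` norm ` ?S"
    using A n by (simp add: spectrum_smult image_image norm_mult)
  have cA: "c \<cdot>\<^sub>m A \<in> carrier_mat n n" using A by simp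
  show ?thesis
  proof (rule antisym)
    from rho_mem_max(1)[OF cA n] obtain l where "l \<in> norm ` ?S" "rho (c \<cdot>\<^sub>m A) = \<bar>c\<bar> * l"
      unfolding S by blast
    with rho_mem_max(2)[OF A n, of l] show "rho (c \<cdot>\<^sub>m A) \<le> \<bar>c\<bar> * rho A"
      by (simp add: mult_left_mono)
    from rho_mem_max(1)[OF A n] show "\<bar>c\<bar> * rho A \<le> rho (c \<cdot>\<^sub>m A)"
      by (intro rho_mem_max(2)[OF cA n]) (auto simp: S)
  qed
qed

section \<open>The weighted inner product\<close>

definition wprod :: "nat \<Rightarrow> (nat \<Rightarrow> real) \<Rightarrow> real vec \<Rightarrow> real vec \<Rightarrow> real" where
  "wprod n \<mu> x y = (\<Sum>i<n. \<mu> i * x $ i * y $ i)"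

lemma wprod_self_pos:
  assumes \<mu>: "\<And>i. i < n \<Longrightarrow> \<mu> i > 0" and z: "z \<in> carrier_vec n" "z \<noteq> 0\<^sub>v n"
  shows "wprod n \<mu> z z > 0"
proof -
  from z obtain i where i: "i < n" "z $ i \<noteq> 0" by (auto simp: vec_eq_iff)
  then have "0 < \<mu> i * z $ i * z $ i" using \<mu> by (simp add: mult.assoc zero_less_mult_iff) linarith
  with i show ?thesis unfolding wprod_def
    by (intro sum_pos2[of _ i]) (auto simp: \<mu> less_imp_le mult.assoc)
qed

text \<open>Expand the nonnegative weighted square of \<open>t * x - y\<close>. With a suitable
  \<open>t\<close> this replaces Cauchy-Schwarz and avoids square roots.\<close>

lemma wprod_amgm:
  assumes \<mu>: "\<And>i. i < n \<Longrightarrow> \<mu> i > 0"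
  shows "2 * t * wprod n \<mu> x y \<le> t\<^sup>2 * wprod n \<mu> x x + wprod n \<mu> y y"
proof -
  have "0 \<le> (\<Sum>i<n. \<mu> i * (t * x $ i - y $ i)\<^sup>2)"
    using \<mu> by (intro sum_nonneg) (auto simp: less_imp_le)
  also have "\<dots> = (\<Sum>i<n. t\<^sup>2 * (\<mu> i * x $ i * x $ i) + \<mu> i * y $ i * y $ i
      - 2 * t * (\<mu> i * x $ i * y $ i))"
    by (intro sum.cong) (auto simp: power2_eq_square algebra_simps)
  also have "\<dots> = t\<^sup>2 * wprod n \<mu> x x + wprod n \<mu> y y - 2 * t * wprod n \<mu> x y"
    by (simp add: wprod_def sum.distrib sum_subtractf sum_distrib_left)
  finally show ?thesis by simp
qed

lemma mult_mat_vec_nth: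
  fixes M :: "'a :: semiring_0 mat"
  assumes "M \<in> carrier_mat n n" and "x \<in> carrier_vec n" and "i < n"
  shows "(M *\<^sub>v x) $ i = (\<Sum>j<n. M $$ (i, j) * x $ j)"
  using assms by (auto simp: scalar_prod_def atLeast0LessThan intro!: sum.cong)

lemma wprod_mult_mat_vec:
  assumes "M \<in> carrier_mat n n" and "y \<in> carrier_vec n"
  shows "wprod n \<mu> x (M *\<^sub>v y) = (\<Sum>i<n. \<Sum>j<n. \<mu> i * M $$ (i, j) * x $ i * y $ j)"
  using assms unfolding wprod_def
  by (intro sum.cong) (auto simp: mult_mat_vec_nth sum_distrib_left mult_ac simp del: index_mult_mat_vec)

text \<open>The hypothesis \<open>sym\<close> says that diag(\<mu>) times \<open>M\<close> is a
  symmetric matrix; exchanging the two summations then moves \<open>M\<close> to the other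
  argument.\<close>

lemma wprod_self_adjoint:
  assumes M: "M \<in> carrier_mat n n" and x: "x \<in> carrier_vec n" and y: "y \<in> carrier_vec n"
    and sym: "\<And>i j. i < n \<Longrightarrow> j < n \<Longrightarrow> \<mu> i * M $$ (i, j) = \<mu> j * M $$ (j, i)"
  shows "wprod n \<mu> x (M *\<^sub>v y) = wprod n \<mu> (M *\<^sub>v x) y"
proof -
  have "wprod n \<mu> x (M *\<^sub>v y) = (\<Sum>j<n. \<Sum>i<n. \<mu> i * M $$ (i, j) * x $ i * y $ j)"
    unfolding wprod_mult_mat_vec[OF M y] by (rule sum.swap)
  also have "\<dots> = wprod n \<mu> y (M *\<^sub>v x)"
    unfolding wprod_mult_mat_vec[OF M x] using sym by (intro sum.cong refl) (auto simp: mult_ac)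
  also have "\<dots> = wprod n \<mu> (M *\<^sub>v x) y" by (simp add: wprod_def mult_ac)
  finally show ?thesis .
qed

section \<open>Rayleigh quotients are at most the spectral radius\<close>

lemma rho_less_1_powers_bounded:
  assumes M: "M \<in> carrier_mat n n" and r: "rho M < 1" and z: "z \<in> carrier_vec n"
    and \<mu>: "\<And>i. i < n \<Longrightarrow> \<mu> i > 0"
  shows "\<exists>C. \<forall>k. wprod n \<mu> (M ^\<^sub>m k *\<^sub>v z) (M ^\<^sub>m k *\<^sub>v z) \<le> C"
proof -
  have "map_mat complex_of_real M \<in> carrier_mat n n" using M by simp
  \<comment> \<open>The Jordan normal form yields a single bound \<open>c\<close> on the entries of
    all powers, independent of the exponent.\<close>
  from spectral_radius_jnf_norm_bound_less_1_upper_triangular[OF this r[unfolded rho_def]]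
  obtain c where c: "\<And>k. norm_bound (map_mat complex_of_real M ^\<^sub>m k) c" by blast
  have entry: "\<bar>(M ^\<^sub>m k) $$ (i, j)\<bar> \<le> c" if "i < n" "j < n" for i j k
  proof -
    have "norm ((map_mat complex_of_real (M ^\<^sub>m k)) $$ (i, j)) \<le> c"
      unfolding of_real_hom.mat_hom_pow[OF M]
      using c[of k] M that by (auto simp: norm_bound_def)
    then show ?thesis using M that by simp
  qed
  define b where "b = (\<Sum>j<n. c * \<bar>z $ j\<bar>)"
  have coord: "\<bar>(M ^\<^sub>m k *\<^sub>v z) $ i\<bar> \<le> b" if "i < n" for i k
  proof -
    have "\<bar>(M ^\<^sub>m k *\<^sub>v z) $ i\<bar> \<le> (\<Sum>j<n. \<bar>(M ^\<^sub>m k) $$ (i, j) * z $ j\<bar>)"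
      unfolding mult_mat_vec_nth[OF pow_carrier_mat[OF M] z that] by (rule sum_abs)
    also have "\<dots> \<le> b" unfolding b_def abs_mult
      using entry[OF that] by (intro sum_mono mult_right_mono) auto
    finally show ?thesis .
  qed
  have "wprod n \<mu> (M ^\<^sub>m k *\<^sub>v z) (M ^\<^sub>m k *\<^sub>v z) \<le> (\<Sum>i<n. \<mu> i * b\<^sup>2)" for k
    unfolding wprod_def mult.assoc power2_eq_square[symmetric]
  proof (intro sum_mono mult_left_mono)
    fix i assume "i \<in> {..<n}"
    then show "((M ^\<^sub>m k *\<^sub>v z) $ i)\<^sup>2 \<le> b\<^sup>2" and "0 \<le> \<mu> i"
      using coord[of i k] \<mu>[of i] by (auto simp: abs_le_square_iff[symmetric] simp del: index_mult_mat_vec)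
  qed
  then show ?thesis by blast
qed

text \<open>If the quotient of \<open>z\<close> were at least \<theta>, the squared norms
  \<open>c k\<close> of the iterates would grow at least like \<open>(\<theta>\<^sup>2) ^ k\<close>,
  contradicting the boundedness of the powers. The strict \<open>\<theta> > 1\<close> makes this
  growth unbounded.\<close>

lemma rayleigh_less_of_rho_less_1:
  assumes M: "M \<in> carrier_mat n n" and r: "rho M < 1"
    and z: "z \<in> carrier_vec n" "z \<noteq> 0\<^sub>v n"
    and \<mu>: "\<And>i. i < n \<Longrightarrow> \<mu> i > 0"
    and sym: "\<And>i j. i < n \<Longrightarrow> j < n \<Longrightarrow> \<mu> i * M $$ (i, j) = \<mu> j * M $$ (j, i)"
    and \<theta>: "\<theta> > 1"
  shows "wprod n \<mu> z (M *\<^sub>v z) < \<theta> * wprod n \<mu> z z"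
proof (rule ccontr)
  assume "\<not> ?thesis"
  then have large: "\<theta> * wprod n \<mu> z z \<le> wprod n \<mu> z (M *\<^sub>v z)" by simp
  define x where "x k = M ^\<^sub>m k *\<^sub>v z" for k
  define c where "c k = wprod n \<mu> (x k) (x k)" for k
  have x: "x k \<in> carrier_vec n" for k
    unfolding x_def using M z by (metis mult_mat_vec_carrier pow_carrier_mat)
  have x0: "x 0 = z" using M z by (simp add: x_def)
  \<comment> \<open>The recursion of matrix powers multiplies by \<open>M\<close> on the right, but
    the iteration needs it on the left.\<close>
  have pow: "M ^\<^sub>m Suc k = M * M ^\<^sub>m k" for k
  proof (induction k)
    case (Suc k)
    have "M ^\<^sub>m Suc (Suc k) = M * M ^\<^sub>m k * M" using Suc by simp
    also have "\<dots> = M * (M ^\<^sub>m k * M)" using M by (intro assoc_mult_mat) auto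
    finally show ?case by simp
  qed (use M in simp)
  have xSuc: "x (Suc k) = M *\<^sub>v x k" for k
    unfolding x_def pow using M z by (intro assoc_mult_mat_vec) auto
  \<comment> \<open>The ratio of successive squared norms never drops below its initial bound.
    Self-adjointness gives \<langle>x k, x (k+2)\<rangle> = c (k+1), and \<open>wprod_amgm\<close>
    at \<open>t = \<theta>\<^sup>2\<close> then carries the bound from \<open>k\<close> to
    \<open>k + 1\<close>; the base case takes \<open>t = \<theta>\<close>.\<close>
  have growth: "\<theta>\<^sup>2 * c k \<le> c (Suc k)" for k
  proof (induction k)
    case 0
    have "\<theta> * (\<theta> * c 0) \<le> \<theta> * wprod n \<mu> (x 0) (x 1)"
      using large \<theta> xSuc[of 0] by (intro mult_left_mono) (auto simp: c_def x0)
    moreover have "2 * \<theta> * wprod n \<mu> (x 0) (x 1) \<le> \<theta>\<^sup>2 * c 0 + c 1"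
      unfolding c_def by (rule wprod_amgm[OF \<mu>])
    ultimately show ?case by (simp add: power2_eq_square)
  next
    case (Suc k)
    have "wprod n \<mu> (x k) (x (Suc (Suc k))) = c (Suc k)"
      using wprod_self_adjoint[OF M x[of k] x[of "Suc k"] sym] by (simp add: xSuc c_def)
    moreover have "2 * \<theta>\<^sup>2 * wprod n \<mu> (x k) (x (Suc (Suc k))) \<le> (\<theta>\<^sup>2)\<^sup>2 * c k + c (Suc (Suc k))"
      unfolding c_def by (rule wprod_amgm[OF \<mu>])
    moreover have "\<theta>\<^sup>2 * (\<theta>\<^sup>2 * c k) \<le> \<theta>\<^sup>2 * c (Suc k)"
      using Suc by (intro mult_left_mono) auto
    ultimately show ?case by (simp add: power2_eq_square[of "\<theta>\<^sup>2"] mult.assoc)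
  qed
  have geometric: "(\<theta>\<^sup>2) ^ k * c 0 \<le> c k" for k
  proof (induction k)
    case (Suc k)
    have "(\<theta>\<^sup>2) ^ Suc k * c 0 \<le> \<theta>\<^sup>2 * c k"
      using mult_left_mono[OF Suc, of "\<theta>\<^sup>2"] by (simp add: mult.assoc)
    with growth[of k] show ?case by linarith
  qed simp
  have c0: "c 0 > 0" unfolding c_def x0 by (rule wprod_self_pos[OF \<mu> z])
  from rho_less_1_powers_bounded[where \<mu> = \<mu>, OF M r z(1) \<mu>] obtain C where C: "\<And>k. c k \<le> C"
    unfolding c_def x_def by blast
  from \<theta> have "1 < \<theta>\<^sup>2" by (simp add: power2_eq_square less_1_mult)
  from real_arch_pow[OF this, of "C / c 0"] obtain k where "C / c 0 < (\<theta>\<^sup>2) ^ k" by blast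
  with c0 have "C < (\<theta>\<^sup>2) ^ k * c 0" by (simp add: field_simps)
  with geometric[of k] C[of k] show False by linarith
qed

lemma wprod_smult_mat:
  assumes "M \<in> carrier_mat n n" and "y \<in> carrier_vec n"
  shows "wprod n \<mu> x ((s \<cdot>\<^sub>m M) *\<^sub>v y) = s * wprod n \<mu> x (M *\<^sub>v y)"
  using assms by (simp add: wprod_mult_mat_vec sum_distrib_left mult_ac)

lemma rayleigh_le_rho:
  assumes M: "M \<in> carrier_mat n n" and n: "n > 0"
    and z: "z \<in> carrier_vec n" "z \<noteq> 0\<^sub>v n"
    and \<mu>: "\<And>i. i < n \<Longrightarrow> \<mu> i > 0"
    and sym: "\<And>i j. i < n \<Longrightarrow> j < n \<Longrightarrow> \<mu> i * M $$ (i, j) = \<mu> j * M $$ (j, i)"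
  shows "wprod n \<mu> z (M *\<^sub>v z) \<le> rho M * wprod n \<mu> z z"
proof (rule ccontr)
  assume "\<not> ?thesis"
  moreover have z0: "wprod n \<mu> z z > 0" by (rule wprod_self_pos[OF \<mu> z])
  ultimately have "rho M < wprod n \<mu> z (M *\<^sub>v z) / wprod n \<mu> z z" by (simp add: field_simps)
  \<comment> \<open>Two intermediate values are needed: dividing \<open>M\<close> by
    \<open>t\<close> brings its spectral radius strictly below 1, and \<open>u / t > 1\<close>
    serves as \<theta>.\<close>
  then obtain t u where t: "rho M < t" "t < u" "u < wprod n \<mu> z (M *\<^sub>v z) / wprod n \<mu> z z"
    using dense by metis
  have t0: "t > 0" using t(1) rho_nonneg[OF M n] by linarith
  have "wprod n \<mu> z ((1 / t) \<cdot>\<^sub>m M *\<^sub>v z) < u / t * wprod n \<mu> z z"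
  proof (rule rayleigh_less_of_rho_less_1[OF _ _ z \<mu>])
    show "rho ((1 / t) \<cdot>\<^sub>m M) < 1" using t t0 by (simp add: rho_smult[OF M n])
  qed (use M sym t t0 in auto)
  then have "wprod n \<mu> z (M *\<^sub>v z) < u * wprod n \<mu> z z"
    using t0 by (simp add: wprod_smult_mat[OF M z(1)] field_simps)
  with t(3) z0 show False by (simp add: field_simps)
qed

section \<open>A nonnegative matrix has a Rayleigh quotient of at least the spectral radius\<close>

lemma rho_le_rayleigh:
  assumes M: "M \<in> carrier_mat n n" and n: "n > 0"
    and \<mu>: "\<And>i. i < n \<Longrightarrow> \<mu> i > 0"
    and nonneg: "\<And>i j. i < n \<Longrightarrow> j < n \<Longrightarrow> M $$ (i, j) \<ge> 0"
  shows "\<exists>w \<in> carrier_vec n. w \<noteq> 0\<^sub>v n \<and> rho M * wprod n \<mu> w w \<le> wprod n \<mu> w (M *\<^sub>v w)"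
proof -
  let ?M = "map_mat complex_of_real M"
  have cM: "?M \<in> carrier_mat n n" using M by simp
  from rho_mem_max(1)[OF M n] obtain l v where l: "rho M = cmod l"
    and v: "v \<in> carrier_vec n" "v \<noteq> 0\<^sub>v n" "?M *\<^sub>v v = l \<cdot>\<^sub>v v"
    using M by (auto simp: spectrum_def eigenvalue_def eigenvector_def)
  define w where "w = map_vec cmod v"
  have w: "w \<in> carrier_vec n" using v by (simp add: w_def)
  have "w \<noteq> 0\<^sub>v n" using v by (auto simp: w_def vec_eq_iff)
  \<comment> \<open>This is the triangle inequality in row \<open>i\<close> of the eigenvector
    equation; nonnegative entries of \<open>M\<close> pass through the modulus unchanged.\<close>
  moreover have "rho M * w $ i \<le> (M *\<^sub>v w) $ i" if i: "i < n" for i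
  proof -
    have "rho M * w $ i = cmod ((?M *\<^sub>v v) $ i)"
      using v i by (simp add: l w_def norm_mult)
    also have "(?M *\<^sub>v v) $ i = (\<Sum>j<n. complex_of_real (M $$ (i, j)) * v $ j)"
      unfolding mult_mat_vec_nth[OF cM v(1) i] using M i by (intro sum.cong) auto
    also have "cmod \<dots> \<le> (\<Sum>j<n. cmod (complex_of_real (M $$ (i, j)) * v $ j))"
      by (rule norm_sum)
    also have "\<dots> = (M *\<^sub>v w) $ i"
      unfolding mult_mat_vec_nth[OF M w i] using v nonneg i
      by (intro sum.cong) (auto simp: norm_mult w_def)
    finally show ?thesis .
  qed
  then have "rho M * wprod n \<mu> w w \<le> wprod n \<mu> w (M *\<^sub>v w)"
    unfolding wprod_def sum_distrib_left
  proof (intro sum_mono)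
    fix i assume le: "\<And>i. i < n \<Longrightarrow> rho M * w $ i \<le> (M *\<^sub>v w) $ i" and "i \<in> {..<n}"
    \<comment> \<open>The weights \<open>\<mu> i * w $ i\<close> are nonnegative, so pairing with
      \<open>w\<close> preserves the coordinatewise inequality.\<close>
    then have "(\<mu> i * w $ i) * (rho M * w $ i) \<le> (\<mu> i * w $ i) * (M *\<^sub>v w) $ i"
      using \<mu> v by (intro mult_left_mono) (auto simp: w_def less_imp_le)
    then show "rho M * (\<mu> i * w $ i * w $ i) \<le> \<mu> i * w $ i * (M *\<^sub>v w) $ i"
      by (simp add: mult_ac)
  qed
  ultimately show ?thesis using w by blast
qed

theorem theorem3:
  fixes N :: nat and \<delta> :: real and \<mu> :: "nat \<Rightarrow> real" and D G :: "real mat"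
  assumes "N \<ge> 1"
    and "\<delta> \<ge> 0"
    and "\<forall>i<N. \<mu> i > 0"
    and "D = mat_diag N \<mu>"
    and "G \<in> carrier_mat N N"
    and "transpose_mat G = G"
    and "\<forall>i<N. \<forall>j<N. G $$ (i, j) \<ge> 0"
    and "\<forall>i<N. G $$ (i, i) = 0"
  shows "(rho (\<delta> \<cdot>\<^sub>m (inv_mat D * map_mat abs G)) < 1
            \<longleftrightarrow> pos_def_mat (D - \<delta> \<cdot>\<^sub>m ((1 / 2) \<cdot>\<^sub>m (G + transpose_mat G))))
       \<and> (rho (\<delta> \<cdot>\<^sub>m (inv_mat D * map_mat abs G)) < 1
            \<longleftrightarrow> \<delta> * rho (inv_mat D * G) < 1)
       \<and> (pos_def_mat (D - \<delta> \<cdot>\<^sub>m ((1 / 2) \<cdot>\<^sub>m (G + transpose_mat G)))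
            \<longleftrightarrow> \<delta> * rho (inv_mat D * G) < 1)"
proof -
  note G = assms(5) and \<delta> = assms(2)
  have N: "N > 0" and \<mu>: "\<And>i. i < N \<Longrightarrow> \<mu> i > 0" using assms(1,3) by auto
  have Gsym: "G $$ (i, j) = G $$ (j, i)" if "i < N" "j < N" for i j
    using arg_cong[OF assms(6), of "\<lambda>A. A $$ (i, j)"] G that by simp
  have absG: "map_mat abs G = G" using G assms(7) by (intro eq_matI) auto
  have half: "(1 / 2) \<cdot>\<^sub>m (G + transpose_mat G) = G"
    unfolding assms(6) using G by (intro eq_matI) auto
  have "mat_diag N (\<lambda>i. \<mu> i * (1 / \<mu> i)) = 1\<^sub>m N"
    using \<mu> by (intro eq_matI) (auto simp: mat_diag_def less_imp_neq[symmetric])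
  then have inv: "inv_mat D = mat_diag N (\<lambda>i. 1 / \<mu> i)"
    unfolding assms(4) by (intro inv_mat_eqI[where n = N]) (auto simp: mult.commute)
  define M where "M = inv_mat D * G"
  have M_eq: "M = Matrix.mat N N (\<lambda>(i, j). 1 / \<mu> i * G $$ (i, j))"
    unfolding M_def inv by (rule mat_diag_mult_left[OF G])
  have M: "M \<in> carrier_mat N N" by (simp add: M_eq)
  \<comment> \<open>Both sides equal the same entry of the symmetric matrix
    \<open>G\<close>.\<close>
  have M_sym: "\<mu> i * M $$ (i, j) = \<mu> j * M $$ (j, i)" if "i < N" "j < N" for i j
    using that \<mu>[of i] \<mu>[of j] Gsym[OF that] by (simp add: M_eq)
  have M_nonneg: "M $$ (i, j) \<ge> 0" if "i < N" "j < N" for i j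
    using that \<mu>[of i] assms(7) by (simp add: M_eq)
  \<comment> \<open>As \<open>D * M\<close> is \<open>G\<close>, the quadratic form of
    \<open>D - \<delta> \<cdot>\<^sub>m G\<close> compares \<langle>z, z\<rangle> with \<delta>
    \<langle>z, M z\<rangle>.\<close>
  have form: "z \<bullet> ((D - \<delta> \<cdot>\<^sub>m G) *\<^sub>v z) = wprod N \<mu> z z - \<delta> * wprod N \<mu> z (M *\<^sub>v z)"
    if z: "z \<in> carrier_vec N" for z
  proof -
    have DG: "D - \<delta> \<cdot>\<^sub>m G \<in> carrier_mat N N" using G by (simp add: assms(4) minus_carrier_mat)
    have row: "((D - \<delta> \<cdot>\<^sub>m G) *\<^sub>v z) $ i = \<mu> i * z $ i - \<delta> * \<mu> i * (M *\<^sub>v z) $ i"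
      if i: "i < N" for i
    proof -
      have "((D - \<delta> \<cdot>\<^sub>m G) *\<^sub>v z) $ i
          = (\<Sum>j<N. (if i = j then \<mu> j * z $ j else 0) - \<delta> * \<mu> i * (M $$ (i, j) * z $ j))"
        unfolding mult_mat_vec_nth[OF DG z i] using G i \<mu>[of i]
        by (intro sum.cong) (auto simp: assms(4) mat_diag_def M_eq algebra_simps)
      also have "\<dots> = \<mu> i * z $ i - \<delta> * \<mu> i * (M *\<^sub>v z) $ i"
        unfolding mult_mat_vec_nth[OF M z i] using i by (simp add: sum_subtractf sum_distrib_left)
      finally show ?thesis .
    qed
    have "z \<bullet> ((D - \<delta> \<cdot>\<^sub>m G) *\<^sub>v z) = (\<Sum>i<N. z $ i * ((D - \<delta> \<cdot>\<^sub>m G) *\<^sub>v z) $ i)"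
      using DG by (auto simp: scalar_prod_def atLeast0LessThan)
    also have "\<dots> = (\<Sum>i<N. \<mu> i * z $ i * z $ i - \<delta> * (\<mu> i * z $ i * (M *\<^sub>v z) $ i))"
      by (intro sum.cong refl) (simp add: row algebra_simps del: index_mult_mat_vec)
    finally show ?thesis by (simp add: wprod_def sum_subtractf sum_distrib_left)
  qed
  have rho_eq: "rho (\<delta> \<cdot>\<^sub>m M) = \<delta> * rho M" using rho_smult[OF M N] \<delta> by simp
  have "pos_def_mat (D - \<delta> \<cdot>\<^sub>m G) \<longleftrightarrow>
      (\<forall>z \<in> carrier_vec N. z \<noteq> 0\<^sub>v N \<longrightarrow> \<delta> * wprod N \<mu> z (M *\<^sub>v z) < wprod N \<mu> z z)"
    using G form by (simp add: pos_def_mat_def assms(4))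
  also have "\<dots> \<longleftrightarrow> \<delta> * rho M < 1"
  proof
    \<comment> \<open>Test the form at the vector \<open>w\<close> whose quotient reaches
      \<open>rho M\<close>, then cancel its positive squared norm.\<close>
    assume pd: "\<forall>z \<in> carrier_vec N. z \<noteq> 0\<^sub>v N \<longrightarrow> \<delta> * wprod N \<mu> z (M *\<^sub>v z) < wprod N \<mu> z z"
    obtain w where w: "w \<in> carrier_vec N" "w \<noteq> 0\<^sub>v N"
      and "rho M * wprod N \<mu> w w \<le> wprod N \<mu> w (M *\<^sub>v w)"
      using rho_le_rayleigh[where \<mu> = \<mu>, OF M N \<mu> M_nonneg] by blast
    then have "\<delta> * (rho M * wprod N \<mu> w w) < wprod N \<mu> w w"
      using pd mult_left_mono[OF _ \<delta>] by (meson le_less_trans)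
    moreover have "wprod N \<mu> w w > 0" by (rule wprod_self_pos[OF \<mu> w])
    ultimately show "\<delta> * rho M < 1"
      using mult_less_cancel_right_pos[of "wprod N \<mu> w w" "\<delta> * rho M" 1] by (simp add: mult.assoc)
  next
    assume small: "\<delta> * rho M < 1"
    show "\<forall>z \<in> carrier_vec N. z \<noteq> 0\<^sub>v N \<longrightarrow> \<delta> * wprod N \<mu> z (M *\<^sub>v z) < wprod N \<mu> z z"
    proof (intro ballI impI)
      fix z :: "real vec" assume z: "z \<in> carrier_vec N" "z \<noteq> 0\<^sub>v N"
      have "\<delta> * wprod N \<mu> z (M *\<^sub>v z) \<le> \<delta> * (rho M * wprod N \<mu> z z)"
        by (rule mult_left_mono[OF rayleigh_le_rho[OF M N z \<mu> M_sym] \<delta>])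
      also have "\<dots> < wprod N \<mu> z z"
        using mult_strict_right_mono[OF small wprod_self_pos[OF \<mu> z]] by (simp add: mult.assoc)
      finally show "\<delta> * wprod N \<mu> z (M *\<^sub>v z) < wprod N \<mu> z z" .
    qed
  qed
  \<comment> \<open>Since \<open>G\<close> equals both its entrywise modulus and its symmetric part,
    and \<delta> factors out of \<open>rho\<close>, all three equivalences reduce to the one just
    proved.\<close>
  finally show ?thesis unfolding absG half M_def[symmetric] rho_eq by blast
qed

end
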